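(* Let $\Gamma$ be a vertex-transitive graph and let $C$ be a clique of $\Gamma$. Then $C$ is a strong clique if and only if $|C|\cdot|I|=|V(\Gamma)|$ for every maximal independent set $I$ of $\Gamma$.
   Context: All graphs are finite and simple. A clique is a set of pairwise adjacent vertices, an independent set a set of pairwise non-adjacent vertices; "maximal" means inclusion-maximal. A clique is called strong if it intersects every maximal independent set of the graph. A graph is vertex-transitive if its automorphism group acts transitively on its vertex set. *)

theory Defs
  imports "HOL-Library.Ramsey" "HOL-Algebra.Group_Action"
begin

text \<open>A finite simple graph is given by a finite vertex set \<open>V\<close> and an edge set
  \<open>E \<subseteq> [V]\<^bsup>2\<^esup>\<close> of two-element subsets of \<open>V\<close>.  The predicates \<^const>\<open>clique\<close> and
  \<^const>\<open>indep\<close> of \<^theory>\<open>HOL-Library.Ramsey\<close> see only \<open>E\<close>, so containment in \<open>V\<close> is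
  always required separately.\<close>

definition maximal_indep :: "'a set \<Rightarrow> 'a set set \<Rightarrow> 'a set \<Rightarrow> bool" where
  "maximal_indep V E I \<longleftrightarrow>
     I \<subseteq> V \<and> indep I E \<and> (\<forall>J. J \<subseteq> V \<and> indep J E \<and> I \<subseteq> J \<longrightarrow> J = I)"

definition strong_clique :: "'a set \<Rightarrow> 'a set set \<Rightarrow> 'a set \<Rightarrow> bool" where
  "strong_clique V E C \<longleftrightarrow>
     C \<subseteq> V \<and> clique C E \<and> (\<forall>I. maximal_indep V E I \<longrightarrow> C \<inter> I \<noteq> {})"

text \<open>As everywhere with \<^const>\<open>Bij\<close>, the permutations are extensional functions on \<open>V\<close>.\<close>

definition graph_auto :: "'a set \<Rightarrow> 'a set set \<Rightarrow> ('a \<Rightarrow> 'a) set" where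
  "graph_auto V E = {f \<in> Bij V. \<forall>u\<in>V. \<forall>v\<in>V. {f u, f v} \<in> E \<longleftrightarrow> {u, v} \<in> E}"

definition graph_AutGroup :: "'a set \<Rightarrow> 'a set set \<Rightarrow> ('a \<Rightarrow> 'a) monoid" where
  "graph_AutGroup V E = BijGroup V \<lparr>carrier := graph_auto V E\<rparr>"

text \<open>\<^locale>\<open>transitive_action\<close> also admits \<open>V = {}\<close>; the null graph has to be excluded by hand.\<close>

definition vertex_transitive :: "'a set \<Rightarrow> 'a set set \<Rightarrow> bool" where
  "vertex_transitive V E \<longleftrightarrow> transitive_action (graph_AutGroup V E) V (\<lambda>f. f)"

lemma subgroup_graph_auto: "subgroup (graph_auto V E) (BijGroup V)"
proof (rule group.subgroupI[OF group_BijGroup])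
  show "graph_auto V E \<subseteq> carrier (BijGroup V)"
    by (auto simp: graph_auto_def BijGroup_def)
  have "(\<lambda>x\<in>V. x) \<in> graph_auto V E"
    by (simp add: graph_auto_def id_Bij)
  then show "graph_auto V E \<noteq> {}"
    by blast
next
  fix f assume f: "f \<in> graph_auto V E"
  then have fB: "f \<in> Bij V" and bij: "bij_betw f V V"
    by (auto simp: graph_auto_def Bij_def)
  have inv_mem: "inv_into V f x \<in> V" "f (inv_into V f x) = x" if "x \<in> V" for x
    using bij that by (auto simp: bij_betw_def inv_into_into f_inv_into_f)
  have "(\<lambda>x\<in>V. inv_into V f x) \<in> graph_auto V E"
    unfolding graph_auto_def
  proof (intro CollectI conjI ballI)
    show "(\<lambda>x\<in>V. inv_into V f x) \<in> Bij V"
      using restrict_inv_into_Bij[OF fB] .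
    fix u v assume uv: "u \<in> V" "v \<in> V"
    have "{f (inv_into V f u), f (inv_into V f v)} \<in> E
        \<longleftrightarrow> {inv_into V f u, inv_into V f v} \<in> E"
      using f inv_mem(1)[OF uv(1)] inv_mem(1)[OF uv(2)] unfolding graph_auto_def by blast
    then show "{(\<lambda>x\<in>V. inv_into V f x) u, (\<lambda>x\<in>V. inv_into V f x) v} \<in> E \<longleftrightarrow> {u, v} \<in> E"
      using inv_mem uv by simp
  qed
  then show "inv\<^bsub>BijGroup V\<^esub> f \<in> graph_auto V E"
    using inv_BijGroup[OF fB] by simp
next
  fix f g assume fg: "f \<in> graph_auto V E" "g \<in> graph_auto V E"
  then have B: "f \<in> Bij V" "g \<in> Bij V"
    by (auto simp: graph_auto_def)
  have mem: "g x \<in> V" if "x \<in> V" for x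
    using B that by (auto simp: Bij_def bij_betw_def)
  have "compose V f g \<in> graph_auto V E"
    using fg B mem by (simp add: graph_auto_def compose_Bij compose_eq)
  then show "f \<otimes>\<^bsub>BijGroup V\<^esub> g \<in> graph_auto V E"
    using B by (simp add: BijGroup_def)
qed

lemma group_action_graph_AutGroup: "group_action (graph_AutGroup V E) V (\<lambda>f. f)"
proof -
  interpret B: group "BijGroup V"
    by (rule group_BijGroup)
  have "group (graph_AutGroup V E)"
    unfolding graph_AutGroup_def by (rule B.subgroup_imp_group[OF subgroup_graph_auto])
  moreover have "(\<lambda>f. f) \<in> hom (graph_AutGroup V E) (BijGroup V)"
    using subgroup.subset[OF subgroup_graph_auto[of V E]]
    by (auto simp: hom_def graph_AutGroup_def)
  ultimately show ?thesis
    by (simp add: group_action_def group_hom_def group_hom_axioms_def B.group_axioms)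
qed

lemma vertex_transitive_iff:
  "vertex_transitive V E \<longleftrightarrow> (\<forall>u\<in>V. \<forall>v\<in>V. \<exists>f\<in>graph_auto V E. f u = v)"
  unfolding vertex_transitive_def transitive_action_def transitive_action_axioms_def
  using group_action_graph_AutGroup[of V E] by (auto simp: graph_AutGroup_def)

end

(* Averaging over the automorphism group G: transitivity makes the number of g in G with g a = b
   equal to |G| / |V| for all a and b, so the mean of |gI \<inter> C| over G is |I| |C| / |V|.
   Each gI is a maximal independent set and meets the clique C in at most one vertex.  Hence all
   the terms |gI \<inter> C| are 1 if and only if their mean is 1. *)

theory Submission
  imports Defs
begin

context transitive_action
begin

text \<open>Here \<open>E\<close> is the set acted on, not an edge set. If \<open>h\<close> maps
  \<open>v\<close> to \<open>u\<close>, right multiplication by \<open>h\<close> embeds the elements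
  taking \<open>u\<close> to \<open>y\<close> into those taking \<open>v\<close> to
  \<open>y\<close>; by symmetry these sets all have the same size. Every group element acts
  bijectively, so it takes exactly one point to \<open>y\<close>, and the sets partition the group
  as \<open>u\<close> runs through \<open>E\<close>.\<close>

lemma card_transporter:
  assumes fin: "finite (carrier G)" and x: "x \<in> E" and y: "y \<in> E"
  shows "card E * card {g \<in> carrier G. \<phi> g x = y} = order G"
proof -
  interpret G: group G
    using group_hom group_hom.axioms(1) by blast
  have le: "card {g \<in> carrier G. \<phi> g u = y} \<le> card {g \<in> carrier G. \<phi> g v = y}"
    if u: "u \<in> E" and v: "v \<in> E" for u v
  proof -
    obtain h where h: "h \<in> carrier G" "\<phi> h v = u"
      using unique_orbit[OF v u] by blast
    show ?thesis
    proof (rule card_inj_on_le)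
      show "inj_on (\<lambda>g. g \<otimes> h) {g \<in> carrier G. \<phi> g u = y}"
        by (rule inj_on_subset[OF G.inj_on_multc[OF h(1)]]) blast
      show "(\<lambda>g. g \<otimes> h) ` {g \<in> carrier G. \<phi> g u = y} \<subseteq> {g \<in> carrier G. \<phi> g v = y}"
      proof (intro subsetI, elim imageE CollectE conjE)
        fix k g assume "k = g \<otimes> h" "g \<in> carrier G" "\<phi> g u = y"
        then show "k \<in> {g \<in> carrier G. \<phi> g v = y}"
          using h composition_rule[OF v] by simp
      qed
    qed (use fin in simp)
  qed
  have pre: "card {u \<in> E. \<phi> g u = y} = 1" if g: "g \<in> carrier G" for g
  proof -
    obtain u where "u \<in> E" "\<phi> g u = y" "\<forall>w\<in>E. \<phi> g w = y \<longrightarrow> w = u"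
      using bij_prop1[OF g y] by metis
    then have "{u \<in> E. \<phi> g u = y} = {u}"
      by blast
    then show ?thesis by simp
  qed
  show ?thesis
  proof (cases "finite E")
    case True
    have "order G = (\<Sum>g\<in>carrier G. card {u \<in> E. \<phi> g u = y})"
      using pre by (simp add: order_def)
    also have "\<dots> = (\<Sum>u\<in>E. card {g \<in> carrier G. \<phi> g u = y})"
      using sum.swap_restrict[OF fin True, of "\<lambda>_ _. 1::nat" "\<lambda>g u. \<phi> g u = y"] by simp
    also have "\<dots> = (\<Sum>u\<in>E. card {g \<in> carrier G. \<phi> g x = y})"
      using le x by (intro sum.cong refl le_antisym) blast+
    finally show ?thesis by simp
  next
    \<comment> \<open>This case is contradictory: \<open>E\<close> is a single orbit of a finite
      group.\<close>
    case False
    have "E \<subseteq> (\<lambda>g. \<phi> g x) ` carrier G"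
      using unique_orbit[OF x] by (metis image_eqI subsetI)
    then show ?thesis
      using False fin finite_surj by blast
  qed
qed

text \<open>Both sides count, up to the factor \<open>card E\<close>, the triples
  \<open>(g, a, b)\<close> with \<open>\<phi> g a = b\<close>: first by \<open>g\<close>, then by
  the pair \<open>(a, b)\<close>. Keeping that factor on the left avoids division in the
  naturals.\<close>

lemma sum_card_translate_Int:
  assumes fin: "finite (carrier G)" "finite E" and A: "A \<subseteq> E" and B: "B \<subseteq> E"
  shows "card E * (\<Sum>g\<in>carrier G. card (\<phi> g ` A \<inter> B)) = order G * (card A * card B)"
proof -
  have finAB: "finite A" "finite B"
    using A B fin(2) finite_subset by blast+
  have "card (\<phi> g ` A \<inter> B) = (\<Sum>a\<in>A. card {b \<in> B. \<phi> g a = b})"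
    if g: "g \<in> carrier G" for g
  proof -
    \<comment> \<open>Injectivity lets points of the translate in \<open>B\<close> be counted by
      their preimages in \<open>A\<close>.\<close>
    have inj: "inj_on (\<phi> g) A"
      using inj_prop[OF g] A inj_on_subset by blast
    have "\<phi> g ` A \<inter> B = \<phi> g ` {a \<in> A. \<phi> g a \<in> B}"
      by blast
    also have "card \<dots> = card {a \<in> A. \<phi> g a \<in> B}"
      using inj by (intro card_image) (auto intro: inj_on_subset)
    also have "\<dots> = (\<Sum>a\<in>A. if \<phi> g a \<in> B then 1 else 0)"
      using finAB by (simp add: sum.If_cases Int_def)
    also have "\<dots> = (\<Sum>a\<in>A. card {b \<in> B. \<phi> g a = b})"
    proof (intro sum.cong refl)
      fix a
      have "{b \<in> B. \<phi> g a = b} = (if \<phi> g a \<in> B then {\<phi> g a} else {})"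
        by auto
      then show "(if \<phi> g a \<in> B then 1 else 0) = card {b \<in> B. \<phi> g a = b}"
        by simp
    qed
    finally show ?thesis .
  qed
  then have "(\<Sum>g\<in>carrier G. card (\<phi> g ` A \<inter> B))
      = (\<Sum>g\<in>carrier G. \<Sum>a\<in>A. card {b \<in> B. \<phi> g a = b})"
    by simp
  also have "\<dots> = (\<Sum>a\<in>A. \<Sum>g\<in>carrier G. card {b \<in> B. \<phi> g a = b})"
    by (rule sum.swap)
  also have "\<dots> = (\<Sum>a\<in>A. \<Sum>b\<in>B. card {g \<in> carrier G. \<phi> g a = b})"
    using sum.swap_restrict[OF fin(1) finAB(2), of "\<lambda>_ _. 1::nat" "\<lambda>g b. \<phi> g _ = b"]
    by (intro sum.cong refl) simp
  finally have "card E * (\<Sum>g\<in>carrier G. card (\<phi> g ` A \<inter> B))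
      = (\<Sum>a\<in>A. \<Sum>b\<in>B. card E * card {g \<in> carrier G. \<phi> g a = b})"
    by (simp add: sum_distrib_left)
  also have "\<dots> = (\<Sum>a\<in>A. \<Sum>b\<in>B. order G)"
    using card_transporter[OF fin(1)] A B by (intro sum.cong refl) blast
  finally show ?thesis
    by (simp add: mult_ac)
qed

end

lemma card_clique_Int_indep_le_1:
  assumes "clique C E" "indep I E"
  shows "card (I \<inter> C) \<le> 1"
proof -
  have "x = y" if "x \<in> I \<inter> C" "y \<in> I \<inter> C" for x y
    using assms that unfolding clique_def indep_def by blast
  then show ?thesis
    \<comment> \<open>An infinite set has \<open>card\<close> 0, which settles that case.\<close>
    using card_le_Suc0_iff_eq[of "I \<inter> C"] by (cases "finite (I \<inter> C)") auto
qed

text \<open>An equivalence, since showing that an image is maximal requires pulling independent sets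
  back along \<open>f\<close> as well as pushing them forward.\<close>

lemma indep_graph_auto_image_iff:
  assumes f: "f \<in> graph_auto V E" and I: "I \<subseteq> V"
  shows "indep (f ` I) E \<longleftrightarrow> indep I E"
proof -
  have "inj_on f I"
    using f I by (auto simp: graph_auto_def Bij_def bij_betw_def intro: inj_on_subset)
  moreover have "{f u, f v} \<in> E \<longleftrightarrow> {u, v} \<in> E" if "u \<in> I" "v \<in> I" for u v
    using f I that unfolding graph_auto_def by blast
  ultimately show ?thesis
    unfolding indep_def by (auto simp: inj_on_eq_iff)
qed

lemma maximal_indep_graph_auto_image:
  assumes f: "f \<in> graph_auto V E" and I: "maximal_indep V E I"
  shows "maximal_indep V E (f ` I)"
  unfolding maximal_indep_def
proof (intro conjI allI impI)
  have im: "f ` V = V"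
    using f by (auto simp: graph_auto_def Bij_def bij_betw_def)
  have inj: "inj_on f V"
    using f by (auto simp: graph_auto_def Bij_def bij_betw_def)
  have IV: "I \<subseteq> V" and indI: "indep I E"
    using I by (auto simp: maximal_indep_def)
  show "f ` I \<subseteq> V"
    using IV im by blast
  show "indep (f ` I) E"
    using indep_graph_auto_image_iff[OF f IV] indI by blast
  fix J assume J: "J \<subseteq> V \<and> indep J E \<and> f ` I \<subseteq> J"
  obtain K where K: "K \<subseteq> V" "J = f ` K"
    using J im by (metis subset_imageE)
  have "indep K E"
    using indep_graph_auto_image_iff[OF f K(1)] J K(2) by blast
  moreover have "I \<subseteq> K"
    using J K IV inj_on_image_mem_iff[OF inj _ K(1)] by blast
  ultimately have "K = I"
    using I K(1) by (auto simp: maximal_indep_def)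
  then show "J = f ` I"
    using K by simp
qed

text \<open>Members of \<open>Bij V\<close> are extensional, hence determined by their values on the
  finite set \<open>V\<close>.\<close>

lemma finite_graph_auto:
  assumes "finite V"
  shows "finite (graph_auto V E)"
proof (rule finite_subset)
  show "graph_auto V E \<subseteq> V \<rightarrow>\<^sub>E V"
    by (auto simp: graph_auto_def Bij_def bij_betw_def PiE_def)
  show "finite (V \<rightarrow>\<^sub>E V)"
    using assms by (simp add: finite_PiE)
qed

theorem theorem3p1:
  fixes V :: "'a set" and E :: "'a set set" and C :: "'a set"
  assumes "finite V" and "V \<noteq> {}" and "E \<subseteq> [V]\<^bsup>2\<^esup>"
    and "vertex_transitive V E"
    and "C \<subseteq> V" and "clique C E"
  shows "strong_clique V E C \<longleftrightarrow>
    (\<forall>I. maximal_indep V E I \<longrightarrow> card C * card I = card V)"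
proof -
  let ?A = "graph_auto V E"
  have finA: "finite ?A"
    using finite_graph_auto assms(1) .
  have id: "(\<lambda>x\<in>V. x) \<in> ?A"
    by (simp add: graph_auto_def id_Bij)
  have A0: "card ?A > 0"
    using finA id card_gt_0_iff by blast
  have carr: "carrier (graph_AutGroup V E) = ?A"
    by (simp add: graph_AutGroup_def)
  have count: "card V * (\<Sum>f\<in>?A. card (f ` I \<inter> C)) = card ?A * (card C * card I)"
    if "I \<subseteq> V" for I
    using transitive_action.sum_card_translate_Int[OF
        assms(4)[unfolded vertex_transitive_def] _ assms(1) that assms(5)] finA
    by (simp add: carr order_def mult_ac)
  show ?thesis
  proof (intro iffI allI impI)
    fix I assume strong: "strong_clique V E C" and I: "maximal_indep V E I"
    have "card (f ` I \<inter> C) = 1" if f: "f \<in> ?A" for f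
    proof -
      have fI: "maximal_indep V E (f ` I)"
        using maximal_indep_graph_auto_image[OF f I] .
      then have "f ` I \<inter> C \<noteq> {}"
        using strong unfolding strong_clique_def by blast
      moreover have "finite (f ` I \<inter> C)"
        using assms(1,5) finite_subset by blast
      moreover have "card (f ` I \<inter> C) \<le> 1"
        using card_clique_Int_indep_le_1[OF assms(6)] fI by (simp add: maximal_indep_def)
      ultimately show ?thesis
        by (metis One_nat_def Suc_leI card_gt_0_iff le_antisym)
    qed
    \<comment> \<open>The sum in \<open>count\<close> has all terms 1, so it equals
      \<open>card ?A\<close>.\<close>
    then have "card V * card ?A = card ?A * (card C * card I)"
      using count[of I] I by (simp add: maximal_indep_def)
    then show "card C * card I = card V"
      using A0 by simp
  next
    assume eq: "\<forall>I. maximal_indep V E I \<longrightarrow> card C * card I = card V"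
    have "C \<inter> I \<noteq> {}" if I: "maximal_indep V E I" for I
    proof
      assume disj: "C \<inter> I = {}"
      have IV: "I \<subseteq> V"
        using I by (simp add: maximal_indep_def)
      have "card V > 0"
        using assms(1,2) by (simp add: card_gt_0_iff)
      then have "(\<Sum>f\<in>?A. card (f ` I \<inter> C)) = card ?A"
        using count[OF IV] eq I by simp
      \<comment> \<open>No term exceeds 1, and the identity contributes 0 because \<open>I\<close>
        misses \<open>C\<close>; this pushes the mean strictly below 1.\<close>
      moreover have "(\<Sum>f\<in>?A. card (f ` I \<inter> C)) < (\<Sum>f\<in>?A. 1)"
      proof (rule sum_strict_mono_ex1[OF finA])
        show "\<forall>f\<in>?A. card (f ` I \<inter> C) \<le> 1"
          using card_clique_Int_indep_le_1[OF assms(6)] maximal_indep_graph_auto_image[OF _ I]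
          by (simp add: maximal_indep_def)
        have "(\<lambda>x\<in>V. x) ` I = I"
          using IV by (auto simp: image_def)
        then have "card ((\<lambda>x\<in>V. x) ` I \<inter> C) < 1"
          using disj by (simp add: Int_commute)
        then show "\<exists>f\<in>?A. card (f ` I \<inter> C) < 1"
          using id by blast
      qed
      ultimately show False
        by simp
    qed
    then show "strong_clique V E C"
      using assms(5,6) by (simp add: strong_clique_def)
  qed
qed

end
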